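(* Let $(X,0)$ be a germ of a complex analytic subvariety of $(\mathbb{C}^n,0)$ and let $\omega=\sum_{j=1}^nA_j\,dx_j$ be a germ of a holomorphic 1-form with isolated singularity at $0\in\mathbb{C}^n$ such that $\mu_{BR}(\omega,X)<\infty$. Let $V=\{f=0\}$ be a germ of a complex hypersurface with an isolated singularity at $0\in\mathbb{C}^n$ invariant by $\omega$. Then $$\mu_{BR}(\omega,X)=\mu_0(\omega)+\overline{\mu}_X(\omega),$$ $$\tau_{BR}(\omega,X,V)=\tau_0(\omega,V)+\overline{\tau}_X(\omega,V).$$ In particular, $$\mu_{BR}(\omega,X)-\tau_{BR}(\omega,X,V)=\mu_0(\omega)-\tau_0(\omega,V)+\overline{\mu}_X(\omega)-\overline{\tau}_X(\omega,V).$$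
   Context: $\mathcal{O}_n$ is the local ring of germs of holomorphic functions at $0\in\mathbb{C}^n$; $\Theta_n$ is the $\mathcal{O}_n$-module of germs of holomorphic vector fields at $0$. For a germ of analytic variety $Z$, $I_Z$ is the ideal of germs vanishing on $Z$; $I_V=\langle f\rangle$. $V$ is invariant by $\omega$ if $T_pV\subset\operatorname{Ker}(\omega_p)$ for every regular point $p$ of $V$. $\Theta_X=\{\xi\in\Theta_n:\xi(I_X)\subseteq I_X\}$ and $\omega(\Theta_X)=\{\omega(\xi):\xi\in\Theta_X\}$. $H_\omega=\{\zeta\in\Theta_n:\omega(\zeta)=0\}$ and $\Theta_V^\omega=\{\delta\in\Theta_n:\omega(\delta)\in\langle f\rangle\}$. Numbers: $\mu_{BR}(\omega,X)=\dim_{\mathbb{C}}\mathcal{O}_n/\omega(\Theta_X)$; $\tau_{BR}(\omega,X,V)=\dim_{\mathbb{C}}\mathcal{O}_n/(\omega(\Theta_X)+I_V)$; $\mu_0(\omega)=\dim_{\mathbb{C}}\mathcal{O}_n/\langle A_1,\ldots,A_n\rangle$; $\tau_0(\omega,V)=\dim_{\mathbb{C}}\mathcal{O}_n/\langle A_1,\ldots,A_n,f\rangle$; $\overline{\mu}_X(\omega)=\dim_{\mathbb{C}}\frac{\Theta_n}{\Theta_X+H_\omega}$; $\overline{\tau}_X(\omega,V)=\dim_{\mathbb{C}}\frac{\Theta_n}{\Theta_X+\Theta_V^\omega}$. *)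

theory Defs
  imports "HOL-Complex_Analysis.Complex_Analysis" "HOL-Library.Extended_Nat"
    "HOL-Library.Extended_Real" "HOL-Library.Set_Algebras"
begin

section \<open>Holomorphic functions of several variables\<close>

definition holo_on :: "(complex^'n \<Rightarrow> complex) \<Rightarrow> (complex^'n) set \<Rightarrow> bool" where
  "holo_on f S \<longleftrightarrow>
     (\<forall>x\<in>S. \<exists>D. (f has_derivative D) (at x) \<and> (\<forall>c v. D (c *s v) = c * D v))"

definition pderiv_at :: "'n \<Rightarrow> (complex^'n \<Rightarrow> complex) \<Rightarrow> complex^'n \<Rightarrow> complex" where
  "pderiv_at j f x = deriv (\<lambda>t. f (x + t *s axis j 1)) 0"

lemma norm_smult_axis [simp]: "norm (c *s axis k (1::complex)) = norm (c::complex)"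
proof -
  have "c *s axis k (1::complex) = axis k c"
    by (auto simp: vec_eq_iff axis_def)
  moreover have "(\<Sum>i\<in>UNIV. (norm (axis k c $ i))\<^sup>2) = (\<Sum>i\<in>UNIV. if i = k then (norm c)\<^sup>2 else 0)"
    by (rule sum.cong) (auto simp: axis_def)
  ultimately show ?thesis
    by (simp add: norm_vec_def L2_set_def)
qed

lemma bounded_linear_smult_axis: "bounded_linear (\<lambda>t::complex. t *s (v :: complex^'n))"
proof (rule linear_conv_bounded_linear[THEN iffD1])
  show "linear (\<lambda>t::complex. t *s v)"
    by (intro linearI) (auto simp: vec_eq_iff algebra_simps)
qed

lemma line_has_field_derivative:
  fixes f :: "complex^'n \<Rightarrow> complex"
  assumes D: "(f has_derivative D) (at (x + t *s v))" and lin: "\<forall>c v. D (c *s v) = c * D v"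
  shows "((\<lambda>t. f (x + t *s v)) has_field_derivative D v) (at t)"
proof -
  have "((\<lambda>t. x + t *s v) has_derivative (\<lambda>t. t *s v)) (at t)"
    using bounded_linear_imp_has_derivative[OF bounded_linear_smult_axis[of v]]
    by (auto intro!: derivative_eq_intros)
  from has_derivative_compose[OF this D]
  moreover have "(*) (D v) = (\<lambda>t. t * D v)"
    by (simp add: fun_eq_iff mult.commute)
  ultimately show ?thesis
    unfolding has_field_derivative_def using lin by simp
qed

lemma holo_on_continuous_on: "holo_on f S \<Longrightarrow> continuous_on S f"
  unfolding holo_on_def
  by (meson continuous_at_imp_continuous_on has_derivative_continuous)

lemma complex_linear_axis_expand:
  fixes D :: "complex^'n \<Rightarrow> complex"
  assumes "linear D" "\<forall>c v. D (c *s v) = c * D v"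
  shows "D v = (\<Sum>k\<in>UNIV. v $ k * D (axis k 1))"
proof -
  have "v = (\<Sum>k\<in>UNIV. v $ k *s axis k 1)"
    by (simp add: basis_expansion)
  then have "D v = D (\<Sum>k\<in>UNIV. v $ k *s axis k 1)"
    by simp
  also have "\<dots> = (\<Sum>k\<in>UNIV. v $ k * D (axis k 1))"
    using assms by (simp add: linear_sum)
  finally show ?thesis .
qed

lemma holo_on_has_derivative:
  assumes "holo_on f S" "x \<in> S"
  shows "(f has_derivative (\<lambda>v. \<Sum>k\<in>UNIV. v $ k * pderiv_at k f x)) (at x)"
proof -
  obtain D where D: "(f has_derivative D) (at x)" "\<forall>c v. D (c *s v) = c * D v"
    using assms unfolding holo_on_def by blast
  have "pderiv_at k f x = D (axis k 1)" for k
    unfolding pderiv_at_def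
    by (rule DERIV_imp_deriv, rule line_has_field_derivative) (use D in auto)
  moreover have "D = (\<lambda>v. \<Sum>k\<in>UNIV. v $ k * D (axis k 1))"
    using complex_linear_axis_expand[OF has_derivative_linear[OF D(1)] D(2)] by blast
  ultimately show ?thesis
    using D by simp
qed

text \<open>Cauchy's integral formula for a partial derivative.\<close>

lemma pderiv_at_integral:
  fixes f :: "complex^'n \<Rightarrow> complex"
  assumes f: "holo_on f (ball x0 (2*r))" and r: "r > 0" and x: "x \<in> ball x0 r"
  shows "pderiv_at k f x =
    integral (cbox 0 1) (\<lambda>s. f (x + (r * exp (2 * pi * \<i> * of_real s)) *s axis k 1)
                                / (r * exp (2 * pi * \<i> * of_real s)))"
proof -
  define h where "h = (\<lambda>t. f (x + t *s axis k 1))"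
  have mem: "x + t *s axis k 1 \<in> ball x0 (2*r)" if "norm t \<le> r" for t
  proof -
    have "dist x0 (x + t *s axis k 1) \<le> dist x0 x + norm (t *s axis k (1::complex))"
      by (metis add.commute add_diff_cancel_left' dist_commute dist_norm dist_triangle)
    then show ?thesis using that x by (simp del: dist_add_cancel)
  qed
  have der: "h field_differentiable (at t)" if t: "norm t \<le> r" for t
  proof -
    obtain D where D: "(f has_derivative D) (at (x + t *s axis k 1))" "\<forall>c v. D (c *s v) = c * D v"
      using f mem[OF t] unfolding holo_on_def by blast
    show ?thesis
      unfolding h_def field_differentiable_def using line_has_field_derivative[OF D] by blast
  qed
  have hol: "h holomorphic_on cball 0 r"
    unfolding holomorphic_on_def
    using der by (auto intro: field_differentiable_at_within)
  have "((\<lambda>u. h u / (u-0) ^ (Suc 1)) has_contour_integral ((2 * pi * \<i>) / (fact 1) * (deriv ^^ 1) h 0))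
           (circlepath 0 r)"
    by (rule Cauchy_has_contour_integral_higher_derivative_circlepath)
       (use hol r in \<open>auto intro: holomorphic_on_imp_continuous_on holomorphic_on_subset\<close>)
  then have "2 * pi * \<i> * deriv h 0 = contour_integral (circlepath 0 r) (\<lambda>u. h u / u^2)"
    using contour_integral_unique by (fastforce simp: power2_eq_square)
  also have "\<dots> = integral {0..1} (\<lambda>s. h (circlepath 0 r s) / (circlepath 0 r s)^2 *
                     vector_derivative (circlepath 0 r) (at s))"
    by (simp add: contour_integral_integral)
  also have "\<dots> = integral {0..1} (\<lambda>s. (2 * pi * \<i>) * (h (r * exp (2 * pi * \<i> * of_real s))
                                / (r * exp (2 * pi * \<i> * of_real s))))"
    by (rule arg_cong2[where f = integral], simp, rule ext)
       (unfold vector_derivative_circlepath, use r in \<open>simp add: circlepath power2_eq_square field_simps\<close>)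
  also have "\<dots> = (2 * pi * \<i>) * integral {0..1} (\<lambda>s. h (r * exp (2 * pi * \<i> * of_real s))
                                / (r * exp (2 * pi * \<i> * of_real s)))"
    by (rule integral_mult_right)
  finally show ?thesis
    unfolding pderiv_at_def h_def[symmetric] by (simp add: h_def)
qed

lemma circle_shift_mem:
  fixes x0 :: "complex^'n"
  assumes "x \<in> ball x0 r" "r > 0"
  shows "x + (r * exp (2 * pi * \<i> * of_real s)) *s axis k 1 \<in> ball x0 (2*r)"
proof -
  let ?t = "r * exp (2 * pi * \<i> * of_real s) :: complex"
  have "dist x0 (x + ?t *s axis k 1) \<le> dist x0 x + norm (?t *s axis k (1::complex))"
    by (metis add.commute add_diff_cancel_left' dist_commute dist_norm dist_triangle)
  also have "norm (?t *s axis k (1::complex)) = r"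
    using assms by (simp add: norm_mult)
  finally show ?thesis using assms by simp
qed

lemma continuous_on_smult_axis [continuous_intros]:
  "continuous_on S f \<Longrightarrow> continuous_on S (\<lambda>x. f x *s (v :: complex^'n))"
  using bounded_linear.continuous_on[OF bounded_linear_smult_axis] .

lemma continuous_on_pderiv_at:
  fixes f :: "complex^'n \<Rightarrow> complex"
  assumes f: "holo_on f S" and S: "open S"
  shows "continuous_on S (pderiv_at k f)"
proof (rule continuous_at_imp_continuous_on, rule ballI)
  fix x0 assume "x0 \<in> S"
  then obtain e where e: "e > 0" "ball x0 e \<subseteq> S"
    using S open_contains_ball by blast
  define r where "r = e / 2"
  have r: "r > 0" "ball x0 (2 * r) \<subseteq> S" using e by (auto simp: r_def)
  have f': "holo_on f (ball x0 (2 * r))" using f r by (auto simp: holo_on_def)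
  note cf = holo_on_continuous_on[OF f']
  have "continuous_on (ball x0 r) (\<lambda>x. integral (cbox 0 1)
     (\<lambda>s. f (x + (r * exp (2 * pi * \<i> * of_real s)) *s axis k 1)
                                / (r * exp (2 * pi * \<i> * of_real s))))"
    by (rule integral_continuous_on_param, unfold split_beta)
       (use r circle_shift_mem[of _ x0 r] in \<open>auto intro!: continuous_intros
         continuous_on_compose2[OF cf]\<close>)
  then have "continuous_on (ball x0 r) (pderiv_at k f)"
    by (rule continuous_on_eq) (use pderiv_at_integral[OF f' r(1)] in auto)
  then show "isCont (pderiv_at k f) x0"
    using r by (simp add: continuous_on_eq_continuous_at)
qed

lemma holo_on_pderiv_at:
  fixes f :: "complex^'n \<Rightarrow> complex"
  assumes f: "holo_on f S" and S: "open S"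
  shows "holo_on (pderiv_at j f) S"
  unfolding holo_on_def
proof
  fix x0 assume "x0 \<in> S"
  then obtain e where e: "e > 0" "ball x0 e \<subseteq> S"
    using S open_contains_ball by blast
  define r where "r = e / 2"
  have r: "r > 0" "ball x0 (2 * r) \<subseteq> S" using e by (auto simp: r_def)
  have f': "holo_on f (ball x0 (2 * r))" using f r by (auto simp: holo_on_def)
  note cf = holo_on_continuous_on[OF f']
  note cp = continuous_on_pderiv_at[OF f' open_ball]
  define c where "c = (\<lambda>s::real. r * exp (2 * pi * \<i> * of_real s) :: complex)"
  have c0: "c s \<noteq> 0" for s using r by (simp add: c_def)
  have cc: "continuous_on T c" for T unfolding c_def by (intro continuous_intros)
  have mem: "x + c s *s axis j 1 \<in> ball x0 (2*r)" if "x \<in> ball x0 r" for x s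
    unfolding c_def using circle_shift_mem[OF that r(1)] .
  define L where "L = (\<lambda>x s v. (\<Sum>k\<in>UNIV. v $ k * pderiv_at k f (x + c s *s axis j 1)) / c s)"
  have bl: "bounded_linear (L x s)" for x s
  proof (rule linear_conv_bounded_linear[THEN iffD1], rule linearI)
    show "L x s (a + b) = L x s a + L x s b" for a b
      unfolding L_def by (simp add: ring_distribs sum.distrib add_divide_distrib)
    show "L x s (u *\<^sub>R b) = u *\<^sub>R L x s b" for u b
    proof -
      have "(\<Sum>k\<in>UNIV. (u *\<^sub>R b) $ k * pderiv_at k f (x + c s *s axis j 1)) =
            u *\<^sub>R (\<Sum>k\<in>UNIV. b $ k * pderiv_at k f (x + c s *s axis j 1))"
        unfolding scaleR_sum_right by (rule sum.cong) simp_all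
      then show ?thesis
        unfolding L_def divide_inverse by (simp only: mult_scaleR_left)
    qed
  qed
  define DD where "DD = (\<lambda>x s. Blinfun (L x s))"
  have DD: "blinfun_apply (DD x s) = L x s" for x s
    unfolding DD_def using bl by (simp add: bounded_linear_Blinfun_apply)
  have cDD: "continuous_on (ball x0 r \<times> cbox 0 1) (\<lambda>(x, s). DD x s)"
    unfolding split_beta
  proof (rule continuous_on_blinfun_componentwise)
    fix i :: "complex^'n"
    show "continuous_on (ball x0 r \<times> cbox 0 1) (\<lambda>p. blinfun_apply (DD (fst p) (snd p)) i)"
      unfolding DD L_def
      by (intro continuous_intros continuous_on_compose2[OF cp] continuous_on_compose2[OF cc[of UNIV]])
         (use c0 mem in auto)
  qed
  have der: "((\<lambda>x. f (x + c s *s axis j 1) / c s) has_derivative blinfun_apply (DD x s))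
          (at x within ball x0 r)" if "x \<in> ball x0 r" for x s
  proof -
    have 1: "((\<lambda>x. x + c s *s axis j 1) has_derivative (\<lambda>v. v)) (at x within ball x0 r)"
      by (auto intro!: derivative_eq_intros)
    have "((\<lambda>x. f (x + c s *s axis j 1)) has_derivative
       (\<lambda>v. \<Sum>k\<in>UNIV. v $ k * pderiv_at k f (x + c s *s axis j 1))) (at x within ball x0 r)"
      using has_derivative_compose[OF 1 holo_on_has_derivative[OF f' mem[OF that]]] .
    then have "((\<lambda>x. f (x + c s *s axis j 1) * inverse (c s)) has_derivative
       (\<lambda>v. (\<Sum>k\<in>UNIV. v $ k * pderiv_at k f (x + c s *s axis j 1)) * inverse (c s))) (at x within ball x0 r)"
      by (rule has_derivative_mult_left)
    then show ?thesis
      unfolding DD L_def by (simp add: divide_inverse)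
  qed
  have "((\<lambda>x. integral (cbox 0 1) (\<lambda>s. f (x + c s *s axis j 1) / c s)) has_derivative
          integral (cbox 0 1) (DD x0)) (at x0 within ball x0 r)"
  proof (rule leibniz_rule[OF der _ cDD])
    show "(\<lambda>s. f (x + c s *s axis j 1) / c s) integrable_on cbox 0 1" if "x \<in> ball x0 r" for x
      by (rule integrable_continuous)
         (use c0 mem[OF that] in \<open>auto intro!: continuous_intros continuous_on_compose2[OF cf]
            continuous_on_compose2[OF cc[of UNIV]]\<close>)
  qed (use r in auto)
  moreover have eq: "pderiv_at j f x = integral (cbox 0 1) (\<lambda>s. f (x + c s *s axis j 1) / c s)"
    if "x \<in> ball x0 r" for x
    unfolding c_def by (rule pderiv_at_integral[OF f' r(1) that])
  moreover have x0r: "x0 \<in> ball x0 r"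
    using r by simp
  ultimately have "(pderiv_at j f has_derivative integral (cbox 0 1) (DD x0)) (at x0 within ball x0 r)"
    using has_derivative_transform[of x0 "ball x0 r" "pderiv_at j f"
      "\<lambda>x. integral (cbox 0 1) (\<lambda>s. f (x + c s *s axis j 1) / c s)"] by blast
  then have "(pderiv_at j f has_derivative integral (cbox 0 1) (DD x0)) (at x0)"
    unfolding at_within_open[OF x0r open_ball] .
  moreover have "integral (cbox 0 1) (DD x0) (a *s v) = a * integral (cbox 0 1) (DD x0) v" for a v
  proof -
    have 1: "continuous_on (cbox (0::real) 1) (\<lambda>s. (x0, s))"
      by (intro continuous_intros)
    have 2: "(\<lambda>s. (x0, s)) ` cbox (0::real) 1 \<subseteq> ball x0 r \<times> cbox 0 1"
      using r by auto
    have "continuous_on (cbox 0 1) (DD x0)"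
      using continuous_on_compose2[OF cDD 1 2] by simp
    then have int: "DD x0 integrable_on cbox 0 1"
      by (rule integrable_continuous)
    have "L x0 s (a *s v) = a * L x0 s v" for s
      by (simp add: L_def sum_distrib_left mult.assoc)
    then show ?thesis
      by (simp only: blinfun_apply_integral[OF int] DD integral_mult_right)
  qed
  ultimately show "\<exists>D. (pderiv_at j f has_derivative D) (at x0) \<and> (\<forall>c v. D (c *s v) = c * D v)"
    by blast
qed


lemma holo_on_subset: "holo_on f S \<Longrightarrow> T \<subseteq> S \<Longrightarrow> holo_on f T"
  by (auto simp: holo_on_def)

lemma holo_on_const: "holo_on (\<lambda>_. a) S"
  unfolding holo_on_def by (auto intro!: exI[of _ "\<lambda>_. 0"])

lemma holo_on_add:
  assumes "holo_on f S" "holo_on g S" shows "holo_on (\<lambda>x. f x + g x) S"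
  unfolding holo_on_def
proof
  fix x assume "x \<in> S"
  then obtain D E where "(f has_derivative D) (at x)" "(g has_derivative E) (at x)"
    "\<forall>c v. D (c *s v) = c * D v" "\<forall>c v. E (c *s v) = c * E v"
    using assms unfolding holo_on_def by metis
  then show "\<exists>D. ((\<lambda>x. f x + g x) has_derivative D) (at x) \<and> (\<forall>c v. D (c *s v) = c * D v)"
    by (intro exI[of _ "\<lambda>v. D v + E v"]) (auto intro: has_derivative_add simp: ring_distribs)
qed

lemma holo_on_mult:
  assumes "holo_on f S" "holo_on g S" shows "holo_on (\<lambda>x. f x * g x) S"
  unfolding holo_on_def
proof
  fix x assume "x \<in> S"
  then obtain D E where "(f has_derivative D) (at x)" "(g has_derivative E) (at x)"
    "\<forall>c v. D (c *s v) = c * D v" "\<forall>c v. E (c *s v) = c * E v"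
    using assms unfolding holo_on_def by metis
  note D = this
  have "((\<lambda>x. f x * g x) has_derivative (\<lambda>v. f x * E v + D v * g x)) (at x)"
    by (rule has_derivative_mult[OF D(1,2)])
  moreover have "f x * E (c *s v) + D (c *s v) * g x = c * (f x * E v + D v * g x)" for c v
    unfolding D(3,4)[rule_format] by (simp add: algebra_simps)
  ultimately show "\<exists>D. ((\<lambda>x. f x * g x) has_derivative D) (at x) \<and> (\<forall>c v. D (c *s v) = c * D v)"
    by blast
qed


section \<open>The local ring of germs at the origin\<close>

definition holo_near_0 :: "(complex^'n \<Rightarrow> complex) \<Rightarrow> bool" where
  "holo_near_0 f \<longleftrightarrow> (\<exists>S. open S \<and> 0 \<in> S \<and> holo_on f S)"

lemma holo_near_0_const: "holo_near_0 (\<lambda>_. a)"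
  unfolding holo_near_0_def using holo_on_const by blast

lemma holo_near_0_add:
  assumes "holo_near_0 f" "holo_near_0 g" shows "holo_near_0 (\<lambda>x. f x + g x)"
proof -
  obtain S T where "open S" "0 \<in> S" "holo_on f S" "open T" "0 \<in> T" "holo_on g T"
    using assms unfolding holo_near_0_def by blast
  then show ?thesis unfolding holo_near_0_def
    by (intro exI[of _ "S \<inter> T"]) (auto intro!: holo_on_add intro: holo_on_subset)
qed

lemma holo_near_0_mult:
  assumes "holo_near_0 f" "holo_near_0 g" shows "holo_near_0 (\<lambda>x. f x * g x)"
proof -
  obtain S T where "open S" "0 \<in> S" "holo_on f S" "open T" "0 \<in> T" "holo_on g T"
    using assms unfolding holo_near_0_def by blast
  then show ?thesis unfolding holo_near_0_def
    by (intro exI[of _ "S \<inter> T"]) (auto intro!: holo_on_mult intro: holo_on_subset)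
qed

lemma holo_near_0_uminus: "holo_near_0 f \<Longrightarrow> holo_near_0 (\<lambda>x. - f x)"
  using holo_near_0_mult[OF holo_near_0_const[of "-1"], of f] by simp

lemma holo_near_0_diff: "holo_near_0 f \<Longrightarrow> holo_near_0 g \<Longrightarrow> holo_near_0 (\<lambda>x. f x - g x)"
  using holo_near_0_add[OF _ holo_near_0_uminus] by fastforce

lemma holo_near_0_pderiv_at: "holo_near_0 f \<Longrightarrow> holo_near_0 (pderiv_at j f)"
  unfolding holo_near_0_def using holo_on_pderiv_at by blast

definition germ_rel :: "(complex^'n \<Rightarrow> complex) \<Rightarrow> (complex^'n \<Rightarrow> complex) \<Rightarrow> bool" where
  "germ_rel f g \<longleftrightarrow> holo_near_0 f \<and> holo_near_0 g \<and> (\<forall>\<^sub>F x in nhds 0. f x = g x)"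

quotient_type 'n hgerm = "complex^'n \<Rightarrow> complex" / partial: germ_rel
proof (rule part_equivpI)
  show "\<exists>f. germ_rel f f"
    by (rule exI[of _ "\<lambda>_. 0"]) (simp add: germ_rel_def holo_near_0_const)
  show "symp germ_rel"
    by (rule sympI) (auto simp: germ_rel_def elim: eventually_mono)
  show "transp germ_rel"
    by (rule transpI) (auto simp: germ_rel_def elim: eventually_elim2)
qed

instantiation hgerm :: (finite) comm_ring_1
begin

lift_definition zero_hgerm :: "'a hgerm" is "\<lambda>_. 0"
  by (simp add: germ_rel_def holo_near_0_const)

lift_definition one_hgerm :: "'a hgerm" is "\<lambda>_. 1"
  by (simp add: germ_rel_def holo_near_0_const)

lift_definition plus_hgerm :: "'a hgerm \<Rightarrow> 'a hgerm \<Rightarrow> 'a hgerm" is "\<lambda>f g x. f x + g x"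
  by (auto simp: germ_rel_def holo_near_0_add elim: eventually_elim2)

lift_definition minus_hgerm :: "'a hgerm \<Rightarrow> 'a hgerm \<Rightarrow> 'a hgerm" is "\<lambda>f g x. f x - g x"
  by (auto simp: germ_rel_def holo_near_0_diff elim: eventually_elim2)

lift_definition uminus_hgerm :: "'a hgerm \<Rightarrow> 'a hgerm" is "\<lambda>f x. - f x"
  by (auto simp: germ_rel_def holo_near_0_uminus elim: eventually_mono)

lift_definition times_hgerm :: "'a hgerm \<Rightarrow> 'a hgerm \<Rightarrow> 'a hgerm" is "\<lambda>f g x. f x * g x"
  by (auto simp: germ_rel_def holo_near_0_mult elim: eventually_elim2)

instance
proof
  fix a b c :: "'a hgerm"
  show "a * b * c = a * (b * c)"
    by transfer (simp add: germ_rel_def holo_near_0_mult mult.assoc)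
  show "a * b = b * a"
    by transfer (simp add: germ_rel_def holo_near_0_mult mult.commute)
  show "1 * a = a"
    by transfer (simp add: germ_rel_def)
  show "a + b + c = a + (b + c)"
    by transfer (simp add: germ_rel_def holo_near_0_add add.assoc)
  show "a + b = b + a"
    by transfer (simp add: germ_rel_def holo_near_0_add add.commute)
  show "0 + a = a"
    by transfer (simp add: germ_rel_def)
  show "- a + a = 0"
    by transfer (simp add: germ_rel_def holo_near_0_const)
  show "a - b = a + - b"
    by transfer (simp add: germ_rel_def holo_near_0_diff)
  show "(a + b) * c = a * c + b * c"
    by transfer (simp add: germ_rel_def holo_near_0_mult holo_near_0_add ring_distribs)
  show "(0::'a hgerm) \<noteq> 1"
    by transfer (auto simp: germ_rel_def dest: eventually_nhds_x_imp_x)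
qed

end

lift_definition hconst :: "complex \<Rightarrow> 'n::finite hgerm" is "\<lambda>c _. c"
  by (simp add: germ_rel_def holo_near_0_const)

lift_definition hpartial :: "'n \<Rightarrow> 'n::finite hgerm \<Rightarrow> 'n hgerm" is pderiv_at
proof -
  fix j :: 'n and f g :: "complex^'n \<Rightarrow> complex"
  assume *: "germ_rel f g"
  then have "\<forall>\<^sub>F y in nhds 0. \<forall>\<^sub>F x in nhds y. f x = g x"
    by (simp add: germ_rel_def eventually_eventually)
  moreover have "pderiv_at j f y = pderiv_at j g y" if "\<forall>\<^sub>F x in nhds y. f x = g x" for y
  proof -
    have "((\<lambda>t. y + t *s axis j 1) \<longlongrightarrow> y + 0 *s axis j 1) (nhds 0)"
      by (intro tendsto_intros bounded_linear.tendsto[OF bounded_linear_smult_axis] filterlim_ident)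
    then have "filterlim (\<lambda>t. y + t *s axis j 1) (nhds y) (nhds (0::complex))"
      by simp
    then have "\<forall>\<^sub>F t in nhds 0. f (y + t *s axis j 1) = g (y + t *s axis j 1)"
      using that by (auto simp: filterlim_iff)
    then show ?thesis
      unfolding pderiv_at_def by (intro deriv_cong_ev) auto
  qed
  ultimately show "germ_rel (pderiv_at j f) (pderiv_at j g)"
    using * by (auto simp: germ_rel_def holo_near_0_pderiv_at elim: eventually_mono)
qed

text \<open>The value of a chosen representative. It is determined by the germ only at the origin and,
  in the sense of the filters \<open>nhds 0\<close> and \<open>at 0\<close>, close to it; it is used nowhere else.\<close>

definition hval :: "'n::finite hgerm \<Rightarrow> complex^'n \<Rightarrow> complex" where
  "hval = rep_hgerm"

lemma hval_abs_hgerm: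
  assumes "holo_near_0 f"
  shows "\<forall>\<^sub>F x in nhds 0. hval (abs_hgerm f) x = f x"
proof -
  have "germ_rel (rep_hgerm (abs_hgerm f)) f"
    by (rule rep_abs_rsp_left[OF Quotient3_hgerm]) (simp add: germ_rel_def assms)
  then show ?thesis by (simp add: germ_rel_def hval_def)
qed

definition ideal_gen :: "'a::comm_ring_1 set \<Rightarrow> 'a set" where
  "ideal_gen S = module.span (*) S"


section \<open>Germs of analytic sets\<close>

text \<open>A germ of a set at the origin is given by a representative; all notions
  below depend only on the set in an arbitrarily small neighbourhood of the origin.\<close>

definition analytic_set_germ :: "(complex^'n) set \<Rightarrow> bool" where
  "analytic_set_germ X \<longleftrightarrow>
     0 \<in> X \<and> (\<exists>G. finite G \<and> (\<forall>\<^sub>F x in nhds 0. x \<in> X \<longleftrightarrow> (\<forall>g\<in>G. hval g x = 0)))"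

definition vanishing_ideal :: "(complex^'n) set \<Rightarrow> 'n hgerm set" where
  "vanishing_ideal Z = {g. \<forall>\<^sub>F x in nhds 0. x \<in> Z \<longrightarrow> hval g x = 0}"

definition holo_map_on :: "(complex^'n \<Rightarrow> complex^'m) \<Rightarrow> (complex^'n) set \<Rightarrow> bool" where
  "holo_map_on \<phi> U \<longleftrightarrow> (\<forall>i. holo_on (\<lambda>x. \<phi> x $ i) U)"

text \<open>\<open>p\<close> is a regular point of \<open>Z\<close> if \<open>Z\<close> is a complex submanifold near \<open>p\<close>: some holomorphic
  chart of the ambient space straightens \<open>Z\<close> to a coordinate subspace.\<close>

definition regular_point :: "(complex^'n) set \<Rightarrow> complex^'n \<Rightarrow> bool" where
  "regular_point Z p \<longleftrightarrow> p \<in> Z \<and>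
     (\<exists>U W \<phi> \<psi> I. open U \<and> open W \<and> p \<in> U \<and> homeomorphism U W \<phi> \<psi> \<and>
        holo_map_on \<phi> U \<and> holo_map_on \<psi> W \<and>
        \<phi> ` (Z \<inter> U) = W \<inter> {y :: complex^'n. \<forall>i\<in>I. y $ i = 0})"

text \<open>The velocities of holomorphic curves in \<open>Z\<close> through \<open>p\<close>; used only at regular points,
  where this is the usual tangent space.\<close>

definition tangent_space :: "(complex^'n) set \<Rightarrow> complex^'n \<Rightarrow> (complex^'n) set" where
  "tangent_space Z p =
     {v. \<exists>\<gamma> r. r > 0 \<and> (\<forall>i. (\<lambda>t. \<gamma> t $ i) holomorphic_on ball 0 r) \<and>
           \<gamma> ` ball 0 r \<subseteq> Z \<and> \<gamma> 0 = p \<and> v = (\<chi> i. deriv (\<lambda>t. \<gamma> t $ i) 0)}"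

definition isolated_singularity_set :: "(complex^'n) set \<Rightarrow> bool" where
  "isolated_singularity_set V \<longleftrightarrow>
     0 \<in> V \<and> \<not> regular_point V 0 \<and> (\<forall>\<^sub>F p in at 0. p \<in> V \<longrightarrow> regular_point V p)"

text \<open>The last conjunct says that \<open>f\<close> is a reduced equation of \<open>V\<close>.\<close>

definition hypersurface_germ :: "(complex^'n) set \<Rightarrow> 'n hgerm \<Rightarrow> bool" where
  "hypersurface_germ V f \<longleftrightarrow>
     f \<noteq> 0 \<and> 0 \<in> V \<and> (\<forall>\<^sub>F x in nhds 0. x \<in> V \<longleftrightarrow> hval f x = 0) \<and>
     vanishing_ideal V = ideal_gen {f}"


section \<open>Vector fields and 1-forms\<close>

text \<open>Both are given by their coefficients: \<open>\<xi>\<close> stands for the sum of the \<open>\<xi> $ j\<close> times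
  \<open>\<partial>/\<partial>x\<^sub>j\<close>, and \<open>\<omega>\<close> for the sum of the \<open>\<omega> $ j\<close> times \<open>dx\<^sub>j\<close>.\<close>

type_synonym 'n vfield = "'n hgerm ^ 'n"
type_synonym 'n oneform = "'n hgerm ^ 'n"

definition vf_apply :: "'n vfield \<Rightarrow> 'n::finite hgerm \<Rightarrow> 'n hgerm" where
  "vf_apply \<xi> g = (\<Sum>j\<in>UNIV. \<xi> $ j * hpartial j g)"

definition form_apply :: "'n oneform \<Rightarrow> 'n vfield \<Rightarrow> 'n::finite hgerm" where
  "form_apply \<omega> \<xi> = (\<Sum>j\<in>UNIV. \<omega> $ j * \<xi> $ j)"

definition isolated_singularity_form :: "'n::finite oneform \<Rightarrow> bool" where
  "isolated_singularity_form \<omega> \<longleftrightarrow>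
     (\<forall>j. hval (\<omega> $ j) 0 = 0) \<and> (\<forall>\<^sub>F p in at 0. \<exists>j. hval (\<omega> $ j) p \<noteq> 0)"

definition invariant_by :: "(complex^'n) set \<Rightarrow> 'n oneform \<Rightarrow> bool" where
  "invariant_by V \<omega> \<longleftrightarrow>
     (\<forall>\<^sub>F p in nhds 0. regular_point V p \<longrightarrow>
        (\<forall>v\<in>tangent_space V p. (\<Sum>j\<in>UNIV. hval (\<omega> $ j) p * v $ j) = 0))"

definition log_vfields :: "(complex^'n) set \<Rightarrow> 'n vfield set" where
  "log_vfields X = {\<xi>. vf_apply \<xi> ` vanishing_ideal X \<subseteq> vanishing_ideal X}"

definition kernel_vfields :: "'n::finite oneform \<Rightarrow> 'n vfield set" where
  "kernel_vfields \<omega> = {\<zeta>. form_apply \<omega> \<zeta> = 0}"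

definition relative_vfields :: "'n::finite oneform \<Rightarrow> 'n hgerm \<Rightarrow> 'n vfield set" where
  "relative_vfields \<omega> f = {\<delta>. form_apply \<omega> \<delta> \<in> ideal_gen {f}}"


section \<open>Dimensions of quotients\<close>

text \<open>\<open>B\<close> maps bijectively onto a basis of the quotient of the whole space by the subspace \<open>W\<close>.\<close>

definition quotient_basis :: "(complex \<Rightarrow> 'a \<Rightarrow> 'a) \<Rightarrow> 'a::ab_group_add set \<Rightarrow> 'a set \<Rightarrow> bool" where
  "quotient_basis sc W B \<longleftrightarrow> finite B \<and>
     (\<forall>c. (\<Sum>b\<in>B. sc (c b) b) \<in> W \<longrightarrow> (\<forall>b\<in>B. c b = 0)) \<and>
     (\<forall>v. \<exists>c. v - (\<Sum>b\<in>B. sc (c b) b) \<in> W)"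

text \<open>All finite bases have the same cardinality, so the infimum only serves to
  select it, and to yield \<open>\<infinity>\<close> if there is none.\<close>

definition quotient_dim :: "(complex \<Rightarrow> 'a \<Rightarrow> 'a) \<Rightarrow> 'a::ab_group_add set \<Rightarrow> enat" where
  "quotient_dim sc W = Inf {enat (card B) |B. quotient_basis sc W B}"

definition germ_scale :: "complex \<Rightarrow> 'n::finite hgerm \<Rightarrow> 'n hgerm" where
  "germ_scale c g = hconst c * g"

definition vfield_scale :: "complex \<Rightarrow> 'n::finite vfield \<Rightarrow> 'n vfield" where
  "vfield_scale c \<xi> = hconst c *s \<xi>"

lemma hconst_simps [simp]:
  "hconst (a + b) = hconst a + (hconst b :: 'n::finite hgerm)"
  "hconst (a * b) = hconst a * (hconst b :: 'n::finite hgerm)"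
  "hconst 0 = (0 :: 'n::finite hgerm)"
  "hconst 1 = (1 :: 'n::finite hgerm)"
  by (transfer, simp add: germ_rel_def holo_near_0_const)+

lemma vector_space_germ_scale: "vector_space (germ_scale :: complex \<Rightarrow> 'n::finite hgerm \<Rightarrow> 'n hgerm)"
  by unfold_locales (simp_all add: germ_scale_def algebra_simps)

lemma vector_space_vfield_scale: "vector_space (vfield_scale :: complex \<Rightarrow> 'n::finite vfield \<Rightarrow> 'n vfield)"
  by unfold_locales (simp_all add: vfield_scale_def vec_eq_iff algebra_simps)


section \<open>Milnor and Tjurina numbers\<close>

definition mu_BR :: "'n::finite oneform \<Rightarrow> (complex^'n) set \<Rightarrow> enat" where
  "mu_BR \<omega> X = quotient_dim germ_scale (form_apply \<omega> ` log_vfields X)"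

definition tau_BR :: "'n::finite oneform \<Rightarrow> (complex^'n) set \<Rightarrow> (complex^'n) set \<Rightarrow> enat" where
  "tau_BR \<omega> X V = quotient_dim germ_scale (form_apply \<omega> ` log_vfields X + vanishing_ideal V)"

definition mu_0 :: "'n::finite oneform \<Rightarrow> enat" where
  "mu_0 \<omega> = quotient_dim germ_scale (ideal_gen (range (($) \<omega>)))"

definition tau_0 :: "'n::finite oneform \<Rightarrow> 'n hgerm \<Rightarrow> enat" where
  "tau_0 \<omega> f = quotient_dim germ_scale (ideal_gen (insert f (range (($) \<omega>))))"

definition mu_bar :: "(complex^'n) set \<Rightarrow> 'n::finite oneform \<Rightarrow> enat" where
  "mu_bar X \<omega> = quotient_dim vfield_scale (log_vfields X + kernel_vfields \<omega>)"

definition tau_bar :: "(complex^'n) set \<Rightarrow> 'n::finite oneform \<Rightarrow> 'n hgerm \<Rightarrow> enat" where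
  "tau_bar X \<omega> f = quotient_dim vfield_scale (log_vfields X + relative_vfields \<omega> f)"

end

theory Submission
  imports Defs
begin

text \<open>Both identities are the additivity of dimension for a linear map \<open>L\<close>, a subspace
  \<open>A\<close> of its source and a subspace \<open>I\<close> of its target: \<open>L\<close> induces an isomorphism from the source
  modulo \<open>A + L\<^sup>-\<^sup>1(I)\<close> onto \<open>range L + I\<close> modulo \<open>L(A) + I\<close>. Here \<open>L\<close> is the contraction
  with \<open>\<omega>\<close>, whose range is the ideal of the coefficients of \<open>\<omega>\<close>, and \<open>A\<close> is
  \<open>\<Theta>\<^sub>X\<close>; the two cases are \<open>I = 0\<close> and \<open>I = I\<^sub>V\<close>.\<close>

section \<open>Dimensions of quotients of vector spaces\<close>

text \<open>The independence clause of \<open>quotient_basis\<close>, split off so that it can be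
  maximised on its own. For finite \<open>B\<close> it says that the classes modulo \<open>W\<close>
  are both distinct and linearly independent.\<close>

definition indep_mod :: "(complex \<Rightarrow> 'a \<Rightarrow> 'a) \<Rightarrow> 'a::ab_group_add set \<Rightarrow> 'a set \<Rightarrow> bool" where
  "indep_mod sc W B \<longleftrightarrow> (\<forall>c. (\<Sum>b\<in>B. sc (c b) b) \<in> W \<longrightarrow> (\<forall>b\<in>B. c b = 0))"

lemma quotient_basis_indep_mod:
  "quotient_basis sc W B \<longleftrightarrow> finite B \<and> indep_mod sc W B \<and> (\<forall>v. \<exists>c. v - (\<Sum>b\<in>B. sc (c b) b) \<in> W)"
  by (simp add: quotient_basis_def indep_mod_def)

lemma indep_mod_antimono: "indep_mod sc W B \<Longrightarrow> W' \<subseteq> W \<Longrightarrow> indep_mod sc W' B"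
  by (auto simp: indep_mod_def)

text \<open>A relation modulo \<open>W\<close> among the images is the image under \<open>L\<close>
  of a relation modulo the preimage of \<open>W\<close>. Injectivity comes first because the sum
  over the image has to be reindexed over \<open>A\<close>.\<close>

lemma indep_mod_linear_image:
  assumes L: "Vector_Spaces.linear s1 s2 L" and W: "module.subspace s2 W"
    and A: "finite A" "indep_mod s1 (L -` W) A"
  shows "inj_on L A" "indep_mod s2 W (L ` A)"
proof -
  interpret L: Vector_Spaces.linear s1 s2 L by fact
  show inj: "inj_on L A"
  proof (rule inj_onI, rule ccontr)
    fix a b assume ab: "a \<in> A" "b \<in> A" "L a = L b" "a \<noteq> b"
    \<comment> \<open>The coefficients of \<open>a - b\<close>, a nontrivial combination that
      \<open>L\<close> sends to 0.\<close>
    define c :: "_ \<Rightarrow> complex" where "c = (\<lambda>x. if x = a then 1 else if x = b then - 1 else 0)"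
    have "(\<Sum>x\<in>A. s1 (c x) x) = (\<Sum>x\<in>{a, b}. s1 (c x) x)"
      using A ab by (intro sum.mono_neutral_right) (auto simp: c_def)
    also have "\<dots> = a - b"
      using ab by (simp add: c_def)
    finally have "(\<Sum>x\<in>A. s1 (c x) x) \<in> L -` W"
      using ab L.vs2.subspace_0[OF W] by (simp add: L.diff)
    then have "c a = 0" using A ab unfolding indep_mod_def by blast
    then show False by (simp add: c_def)
  qed
  show "indep_mod s2 W (L ` A)"
    unfolding indep_mod_def
  proof (intro allI impI)
    fix c assume "(\<Sum>b\<in>L ` A. s2 (c b) b) \<in> W"
    then have "(\<Sum>a\<in>A. s1 (c (L a)) a) \<in> L -` W"
      using inj by (simp add: sum.reindex L.sum L.scale)
    then show "\<forall>b\<in>L ` A. c b = 0"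
      using A unfolding indep_mod_def by fastforce
  qed
qed

section \<open>Bases modulo a subspace: exchange, existence and cardinality\<close>

context vector_space
begin

text \<open>Extend a basis of \<open>W\<close> to the whole space, kill the part in \<open>W\<close>
  and fix the rest. The image of this projection serves as a model of the quotient by
  \<open>W\<close>, so that \<open>independent\<close> and \<open>span\<close> apply to it.\<close>

lemma ex_linear_kernel_eq:
  assumes W: "subspace W"
  obtains p where "Vector_Spaces.linear scale scale p" "p -` {0} = W"
proof -
  interpret vector_space_pair scale scale ..
  obtain C where C: "C \<subseteq> W" "independent C" "W \<subseteq> span C"
    using basis_exists by metis
  define E where "E = extend_basis C"
  have E: "C \<subseteq> E" "independent E" "span E = UNIV"
    using C by (simp_all add: E_def extend_basis_superset independent_extend_basis)
  define p where "p = construct E (\<lambda>b. if b \<in> C then 0 else b)"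
  have lin: "Vector_Spaces.linear scale scale p"
    unfolding p_def by (rule linear_construct[OF E(2)])
  interpret p: Vector_Spaces.linear scale scale p by fact
  have pE: "p b = (if b \<in> C then 0 else b)" if "b \<in> E" for b
    unfolding p_def using construct_basis[OF E(2) that] .
  \<comment> \<open>On a basis vector the difference is either the vector itself, lying in
    \<open>W\<close>, or 0. This yields that the kernel of \<open>p\<close> lies in
    \<open>W\<close>.\<close>
  have "v - p v \<in> W" for v
  proof (rule span_induct[of v E])
    show "subspace {v. v - p v \<in> W}"
    proof (rule subspaceI)
      fix x y assume "x \<in> {v. v - p v \<in> W}" "y \<in> {v. v - p v \<in> W}"
      then have "(x - p x) + (y - p y) \<in> W" using subspace_add[OF W] by blast
      then show "x + y \<in> {v. v - p v \<in> W}" by (simp add: p.add algebra_simps)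
    next
      fix c x assume "x \<in> {v. v - p v \<in> W}"
      then have "scale c (x - p x) \<in> W" using subspace_scale[OF W] by blast
      then show "scale c x \<in> {v. v - p v \<in> W}" by (simp add: p.scale algebra_simps)
    qed (simp add: subspace_0[OF W])
    show "b - p b \<in> W" if "b \<in> E" for b
      using pE[OF that] C subspace_0[OF W] by auto
  qed (simp add: E)
  then have "p v = 0 \<Longrightarrow> v \<in> W" for v
    by (metis diff_zero)
  moreover have "p v = 0" if "v \<in> W" for v
    by (rule p.eq_0_on_span[of C]) (use pE C E that in auto)
  ultimately have "p -` {0} = W" by auto
  with lin show ?thesis by (rule that)
qed

end

text \<open>Fixes the complex scalars that \<open>quotient_basis\<close> and
  \<open>indep_mod\<close> ask for.\<close>

locale complex_vector_space = vector_space scale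
  for scale :: "complex \<Rightarrow> 'a::ab_group_add \<Rightarrow> 'a"
begin

text \<open>The exchange lemma in the quotient: a projection with kernel \<open>W\<close> maps
  \<open>A\<close> injectively onto an independent set lying in the span of the image of
  \<open>S\<close>.\<close>

lemma card_indep_mod_le:
  assumes W: "subspace W" and A: "finite A" "indep_mod scale W A"
    and S: "finite S" "\<forall>v. \<exists>c. v - (\<Sum>b\<in>S. scale (c b) b) \<in> W"
  shows "card A \<le> card S"
proof -
  obtain p where lin: "Vector_Spaces.linear scale scale p" and ker: "p -` {0} = W"
    using ex_linear_kernel_eq[OF W] .
  interpret p: Vector_Spaces.linear scale scale p by fact
  have inj: "inj_on p A" and "indep_mod scale {0} (p ` A)"
    using indep_mod_linear_image[OF lin subspace_single_0 A(1)] A(2) by (auto simp: ker)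
  then have "independent (p ` A)"
    using A by (subst dependent_finite) (auto simp: indep_mod_def)
  moreover have "p v \<in> span (p ` S)" for v
  proof -
    obtain c where "v - (\<Sum>b\<in>S. scale (c b) b) \<in> p -` {0}"
      using S ker by blast
    then have "p v = (\<Sum>b\<in>S. scale (c b) (p b))"
      by (simp add: p.diff p.sum p.scale)
    then show ?thesis
      by (simp add: span_sum span_scale span_base)
  qed
  ultimately have "card (p ` A) \<le> card (p ` S)"
    using independent_span_bound[of "p ` S" "p ` A"] S by blast
  then show ?thesis
    using card_image[OF inj] card_image_le[OF S(1), of p] by simp
qed

text \<open>Since cardinalities are bounded, there is a largest finite set independent modulo
  \<open>W\<close>; by maximality it also spans modulo \<open>W\<close>.\<close>

lemma quotient_basis_exists:
  assumes W: "subspace W"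
    and bound: "\<And>B. finite B \<Longrightarrow> indep_mod scale W B \<Longrightarrow> card B \<le> n"
  shows "\<exists>B. quotient_basis scale W B"
proof -
  define B where "B = (ARG_MAX card B. finite B \<and> indep_mod scale W B)"
  have "finite {} \<and> indep_mod scale W {}"
    by (simp add: indep_mod_def)
  \<comment> \<open>The bound on the measure has to be strict, hence \<open>Suc n\<close>.\<close>
  from arg_max_nat_lemma[of "\<lambda>B. finite B \<and> indep_mod scale W B", OF this, of card "Suc n"] bound
  have B: "finite B" "indep_mod scale W B"
    and max: "\<And>B'. finite B' \<Longrightarrow> indep_mod scale W B' \<Longrightarrow> card B' \<le> card B"
    unfolding B_def by (auto simp: less_Suc_eq_le)
  have "\<exists>c. v - (\<Sum>b\<in>B. scale (c b) b) \<in> W" for v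
  proof (rule ccontr)
    assume nex: "\<nexists>c. v - (\<Sum>b\<in>B. scale (c b) b) \<in> W"
    have vB: "v \<notin> B"
    proof
      assume "v \<in> B"
      then have "(\<Sum>b\<in>B. scale (if b = v then 1 else 0) b) = v"
        using B by (simp add: if_distrib[of "\<lambda>c. scale c _"] cong: if_cong)
      then show False
        using nex subspace_0[OF W] by (metis diff_self)
    qed
    have "indep_mod scale W (insert v B)"
      unfolding indep_mod_def
    proof (intro allI impI)
      fix c assume c: "(\<Sum>b\<in>insert v B. scale (c b) b) \<in> W"
      then have c': "scale (c v) v + (\<Sum>b\<in>B. scale (c b) b) \<in> W"
        using B vB by simp
      have cv: "c v = 0"
      proof (rule ccontr)
        assume "c v \<noteq> 0"
        \<comment> \<open>Solving the relation for \<open>v\<close> would express it through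
          \<open>B\<close> modulo \<open>W\<close>, against the choice of \<open>v\<close>.\<close>
        then have "v - (\<Sum>b\<in>B. scale (- c b / c v) b) =
            scale (inverse (c v)) (scale (c v) v + (\<Sum>b\<in>B. scale (c b) b))"
          by (simp add: scale_right_distrib scale_sum_right sum_negf divide_inverse mult.commute)
        then show False
          using nex subspace_scale[OF W c'] by metis
      qed
      then show "\<forall>b\<in>insert v B. c b = 0"
        using c' B by (auto simp: indep_mod_def)
    qed
    then have "card (insert v B) \<le> card B"
      using max B by blast
    then show False using B vB by simp
  qed
  then show ?thesis
    using B unfolding quotient_basis_indep_mod by blast
qed

text \<open>Exchange in both directions gives all bases one cardinality, so the infimum is taken
  over a singleton.\<close>

lemma quotient_dim_eq:
  assumes "subspace W" "quotient_basis scale W B"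
  shows "quotient_dim scale W = enat (card B)"
proof -
  have eq: "card B' = card B" if "quotient_basis scale W B'" for B'
    using assms that unfolding quotient_basis_indep_mod
    by (intro order_antisym card_indep_mod_le[of W]) auto
  show ?thesis
    unfolding quotient_dim_def
  proof (rule antisym[OF Inf_lower Inf_greatest])
    show "enat (card B) \<in> {enat (card B') |B'. quotient_basis scale W B'}"
      using assms by blast
    show "enat (card B) \<le> x" if "x \<in> {enat (card B') |B'. quotient_basis scale W B'}" for x
      using that eq by fastforce
  qed
qed

text \<open>Independence modulo the larger \<open>P\<close> implies independence modulo
  \<open>W\<close>, so \<open>card B\<close> bounds the sets to be considered.\<close>

lemma quotient_dim_antimono_finite:
  assumes "subspace W" "subspace P" "W \<subseteq> P" "quotient_basis scale W B"
  shows "\<exists>B. quotient_basis scale P B"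
proof (rule quotient_basis_exists[OF assms(2)])
  fix C assume "finite C" "indep_mod scale P C"
  then show "card C \<le> card B"
    using card_indep_mod_le[OF assms(1) _ indep_mod_antimono] assms(3,4)
    unfolding quotient_basis_indep_mod by blast
qed

end

text \<open>Each basis is finite and bounds the infimum by a natural number; the infimum of the
  empty set is \<open>\<infinity>\<close>.\<close>

lemma quotient_dim_eq_infinity_iff:
  "quotient_dim sc W = \<infinity> \<longleftrightarrow> (\<nexists>B. quotient_basis sc W B)"
proof -
  have "quotient_dim sc W \<le> enat (card B)" if "quotient_basis sc W B" for B
    unfolding quotient_dim_def using that by (intro Inf_lower) blast
  moreover have "\<nexists>B. quotient_basis sc W B \<Longrightarrow> quotient_dim sc W = \<infinity>"
    by (simp add: quotient_dim_def Inf_enat_def)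
  ultimately show ?thesis by (metis enat_ord_code(5) order.refl enat.distinct(1) enat_ile)
qed

section \<open>Sums of subspaces and additivity of dimension along a linear map\<close>

lemma subspace_plus:
  assumes "module sc" "module.subspace sc A" "module.subspace sc B"
  shows "module.subspace sc (A + B)"
proof (rule module.subspaceI[OF assms(1)])
  show "0 \<in> A + B"
    using assms(2,3)[THEN module.subspace_0[OF assms(1)]] set_plus_intro[of 0 A 0 B] by simp
next
  fix x y assume "x \<in> A + B" "y \<in> A + B"
  then obtain a b a' b' where ab: "a \<in> A" "b \<in> B" "a' \<in> A" "b' \<in> B" "x = a + b" "y = a' + b'"
    by (elim set_plus_elim)
  then have "(a + a') + (b + b') \<in> A + B"
    using assms by (intro set_plus_intro module.subspace_add[OF assms(1)])
  then show "x + y \<in> A + B" using ab by (simp add: algebra_simps)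
next
  fix c x assume "x \<in> A + B"
  then obtain a b where ab: "a \<in> A" "b \<in> B" "x = a + b" by (elim set_plus_elim)
  then have "sc c a + sc c b \<in> A + B"
    using assms by (intro set_plus_intro module.subspace_scale[OF assms(1)])
  then show "sc c x \<in> A + B"
    using ab module.scale_right_distrib[OF assms(1)] by simp
qed

text \<open>Rank-nullity for the map that \<open>L\<close> induces into the target modulo
  \<open>W\<close>: its kernel is the preimage of \<open>W\<close>, its cokernel the target modulo
  \<open>range L + W\<close>. A basis \<open>B\<close> of the cokernel and the image of a basis
  \<open>C\<close> of the source modulo the kernel together form a basis modulo
  \<open>W\<close>.\<close>

lemma quotient_dim_linear:
  assumes L: "Vector_Spaces.linear s1 s2 L"
    and W: "module.subspace s2 W"
  shows "quotient_dim s2 W = quotient_dim s2 (range L + W) + quotient_dim s1 (L -` W)"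
proof -
  interpret L: Vector_Spaces.linear s1 s2 L by fact
  interpret v1: complex_vector_space s1 ..
  interpret v2: complex_vector_space s2 ..
  have P: "L.vs2.subspace (range L + W)"
    by (intro subspace_plus L.vs2.module_axioms L.subspace_image L.vs1.subspace_UNIV W)
  have K: "L.vs1.subspace (L -` W)"
    using L.subspace_vimage[OF W] .
  have WP: "W \<subseteq> range L + W"
  proof
    fix w assume "w \<in> W"
    then have "L 0 + w \<in> range L + W" by (intro set_plus_intro rangeI)
    then show "w \<in> range L + W" by (simp add: L.zero)
  qed
  show ?thesis
  proof (cases "(\<exists>B. quotient_basis s2 (range L + W) B) \<and> (\<exists>C. quotient_basis s1 (L -` W) C)")
    case True
    then obtain B C where B: "quotient_basis s2 (range L + W) B"
      and C: "quotient_basis s1 (L -` W) C" by blast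
    have fin: "finite B" "finite C"
      using B C by (auto simp: quotient_basis_def)
    have inj: "inj_on L C" and ind: "indep_mod s2 W (L ` C)"
      using indep_mod_linear_image[OF L W] C by (auto simp: quotient_basis_indep_mod)
    have B0: "\<forall>b\<in>B. c b = 0" if "(\<Sum>b\<in>B. s2 (c b) b) \<in> range L + W" for c
      using B that unfolding quotient_basis_def by blast
    \<comment> \<open>A common element would vanish modulo \<open>range L + W\<close>, where
      \<open>B\<close> is independent.\<close>
    have disj: "B \<inter> L ` C = {}"
    proof (rule ccontr)
      assume "B \<inter> L ` C \<noteq> {}"
      then obtain a where a: "L a \<in> B" by blast
      have "L a + 0 \<in> range L + W"
        using L.vs2.subspace_0[OF W] by (intro set_plus_intro) auto
      moreover have "(\<Sum>b\<in>B. s2 (if b = L a then 1 else 0) b) = L a"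
        using a fin by (simp add: if_distrib[of "\<lambda>c. s2 c _"] cong: if_cong)
      ultimately have "\<forall>b\<in>B. (if b = L a then 1 else 0) = (0::complex)"
        by (intro B0) simp
      then show False using a by auto
    qed
    have sum_split: "(\<Sum>b\<in>B \<union> L ` C. s2 (c b) b) =
        (\<Sum>b\<in>B. s2 (c b) b) + (\<Sum>b\<in>L ` C. s2 (c b) b)" for c
      using fin disj by (simp add: sum.union_disjoint)
    have sumC: "(\<Sum>b\<in>L ` C. s2 (c b) b) = L (\<Sum>a\<in>C. s1 (c (L a)) a)" for c
      using inj by (simp add: sum.reindex L.sum L.scale)
    have "quotient_basis s2 W (B \<union> L ` C)"
      unfolding quotient_basis_indep_mod
    proof (intro conjI allI)
      show "indep_mod s2 W (B \<union> L ` C)"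
        unfolding indep_mod_def
      proof (intro allI impI)
        fix c assume c: "(\<Sum>b\<in>B \<union> L ` C. s2 (c b) b) \<in> W"
        \<comment> \<open>Modulo \<open>range L + W\<close> only the terms from \<open>B\<close>
          survive, so their coefficients vanish first; the remaining relation is then one among the
          images of \<open>C\<close>.\<close>
        have "L (- (\<Sum>a\<in>C. s1 (c (L a)) a)) + (\<Sum>b\<in>B \<union> L ` C. s2 (c b) b) \<in> range L + W"
          using c by (intro set_plus_intro rangeI)
        then have cB: "\<forall>b\<in>B. c b = 0"
          by (intro B0) (simp add: sum_split sumC L.neg)
        then have "(\<Sum>b\<in>L ` C. s2 (c b) b) \<in> W"
          using c by (simp add: sum_split)
        then show "\<forall>b\<in>B \<union> L ` C. c b = 0"
          using cB ind unfolding indep_mod_def by blast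
      qed
      fix v
      obtain c where "v - (\<Sum>b\<in>B. s2 (c b) b) \<in> range L + W"
        using B unfolding quotient_basis_def by blast
      then obtain x w where x: "v - (\<Sum>b\<in>B. s2 (c b) b) = L x + w" "w \<in> W"
        by (auto elim: set_plus_elim)
      obtain d where d: "L (x - (\<Sum>a\<in>C. s1 (d a) a)) \<in> W"
        using C unfolding quotient_basis_def by blast
      \<comment> \<open>Glues the coefficients \<open>c\<close> on \<open>B\<close> to
        \<open>d\<close> on \<open>C\<close>, the latter carried over by the inverse of
        \<open>L\<close> on \<open>C\<close>; \<open>disj\<close> keeps the two from
        clashing.\<close>
      define e where "e = (\<lambda>b. if b \<in> B then c b else d (the_inv_into C L b))"
      have "(\<Sum>b\<in>B. s2 (e b) b) = (\<Sum>b\<in>B. s2 (c b) b)"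
        by (simp add: e_def)
      moreover have "(\<Sum>a\<in>C. s1 (e (L a)) a) = (\<Sum>a\<in>C. s1 (d a) a)"
        using disj inj by (intro sum.cong) (auto simp: e_def the_inv_into_f_f)
      ultimately have "v - (\<Sum>b\<in>B \<union> L ` C. s2 (e b) b) = L (x - (\<Sum>a\<in>C. s1 (d a) a)) + w"
        using x by (simp add: sum_split sumC L.diff algebra_simps)
      then show "\<exists>e. v - (\<Sum>b\<in>B \<union> L ` C. s2 (e b) b) \<in> W"
        using L.vs2.subspace_add[OF W d x(2)] by metis
    qed (use fin in simp)
    from v2.quotient_dim_eq[OF W this] show ?thesis
      using v2.quotient_dim_eq[OF P B] v1.quotient_dim_eq[OF K C] fin disj
      by (simp add: card_Un_disjoint card_image[OF inj])
  next
    case False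
    \<comment> \<open>A basis modulo \<open>W\<close> would bound the independent sets in both other
      quotients and so give bases of both.\<close>
    have "\<nexists>B. quotient_basis s2 W B"
    proof
      assume "\<exists>B. quotient_basis s2 W B"
      then obtain B where B: "quotient_basis s2 W B" by blast
      have "card C \<le> card B" if "finite C" "indep_mod s1 (L -` W) C" for C
        using indep_mod_linear_image[OF L W that] B that(1)
          v2.card_indep_mod_le[OF W, of "L ` C" B]
        by (auto simp: quotient_basis_indep_mod card_image)
      then show False
        using False v2.quotient_dim_antimono_finite[OF W P WP B] v1.quotient_basis_exists[OF K]
        by blast
    qed
    then have "quotient_dim s2 W = \<infinity>"
      by (simp add: quotient_dim_eq_infinity_iff)
    moreover have "quotient_dim s2 (range L + W) = \<infinity> \<or> quotient_dim s1 (L -` W) = \<infinity>"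
      using False by (simp only: quotient_dim_eq_infinity_iff) blast
    ultimately show ?thesis by auto
  qed
qed

text \<open>Rank-nullity with \<open>W\<close> the sum of the image of \<open>A\<close> and
  \<open>I\<close>: \<open>range L\<close> absorbs the image of \<open>A\<close>, and
  \<open>L x = L a + i\<close> means that \<open>x - a\<close> is mapped into
  \<open>I\<close>.\<close>

lemma quotient_dim_image_plus:
  assumes L: "Vector_Spaces.linear s1 s2 L"
    and A: "module.subspace s1 A" and I: "module.subspace s2 I"
  shows "quotient_dim s2 (L ` A + I) =
    quotient_dim s2 (range L + I) + quotient_dim s1 (A + L -` I)"
proof -
  interpret L: Vector_Spaces.linear s1 s2 L by fact
  have W: "L.vs2.subspace (L ` A + I)"
    by (intro subspace_plus L.vs2.module_axioms L.subspace_image A I)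
  have "range L + (L ` A + I) = range L + I"
  proof (intro equalityI subsetI)
    fix y assume "y \<in> range L + (L ` A + I)"
    then obtain x a i where "y = L x + (L a + i)" "i \<in> I"
      by (auto elim!: set_plus_elim)
    then have "y = L (x + a) + i" "i \<in> I" by (simp_all add: L.add add.assoc)
    then show "y \<in> range L + I" by (auto intro: set_plus_intro)
  next
    fix y assume "y \<in> range L + I"
    then obtain x i where y: "y = L x + (L 0 + i)" "i \<in> I"
      by (auto simp: L.zero elim!: set_plus_elim)
    show "y \<in> range L + (L ` A + I)"
      unfolding y using y(2) L.vs1.subspace_0[OF A] by (intro set_plus_intro imageI rangeI)
  qed
  moreover have "L -` (L ` A + I) = A + L -` I"
  proof (intro equalityI subsetI)
    fix x assume "x \<in> L -` (L ` A + I)"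
    then obtain a i where ai: "L x = L a + i" "a \<in> A" "i \<in> I"
      by (auto elim!: set_plus_elim)
    then have "a + (x - a) \<in> A + L -` I"
      by (intro set_plus_intro) (auto simp: L.diff)
    then show "x \<in> A + L -` I" by simp
  next
    fix x assume "x \<in> A + L -` I"
    then show "x \<in> L -` (L ` A + I)"
      by (auto simp: L.add elim!: set_plus_elim intro!: set_plus_intro)
  qed
  ultimately show ?thesis using quotient_dim_linear[OF L W] by simp
qed

section \<open>Germs of vector fields and 1-forms\<close>

lemma module_mult: "module ((*) :: 'a::comm_ring_1 \<Rightarrow> 'a \<Rightarrow> 'a)"
  by unfold_locales (simp_all add: algebra_simps)

text \<open>Lets ring operations on germs be computed pointwise on chosen representatives, close to
  the origin.\<close>

lemma hval_eq_rep:
  assumes "germ_rel F F" "g = abs_hgerm F"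
  shows "\<forall>\<^sub>F x in nhds 0. hval g x = F x"
  using hval_abs_hgerm assms by (auto simp: germ_rel_def)

lemma hval_0: "\<forall>\<^sub>F x in nhds 0. hval (0 :: 'n::finite hgerm) x = 0"
  unfolding zero_hgerm_def by (rule hval_abs_hgerm) (rule holo_near_0_const)

lemma germ_rel_hval: "germ_rel (hval g) (hval (g :: 'n::finite hgerm))"
  unfolding hval_def by (rule Quotient3_rep_reflp[OF Quotient3_hgerm])

lemma abs_hval: "abs_hgerm (hval g) = (g :: 'n::finite hgerm)"
  unfolding hval_def by (rule Quotient3_abs_rep[OF Quotient3_hgerm])

lemma hval_add:
  "\<forall>\<^sub>F x in nhds 0. hval (g + h :: 'n::finite hgerm) x = hval g x + hval h x"
proof (rule hval_eq_rep)
  show "germ_rel (\<lambda>x. hval g x + hval h x) (\<lambda>x. hval g x + hval h x)"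
    using germ_rel_hval[of g] germ_rel_hval[of h] by (simp add: germ_rel_def holo_near_0_add)
  show "g + h = abs_hgerm (\<lambda>x. hval g x + hval h x)"
    by (simp add: plus_hgerm_def hval_def)
qed

lemma hval_mult:
  "\<forall>\<^sub>F x in nhds 0. hval (g * h :: 'n::finite hgerm) x = hval g x * hval h x"
proof (rule hval_eq_rep)
  show "germ_rel (\<lambda>x. hval g x * hval h x) (\<lambda>x. hval g x * hval h x)"
    using germ_rel_hval[of g] germ_rel_hval[of h] by (simp add: germ_rel_def holo_near_0_mult)
  show "g * h = abs_hgerm (\<lambda>x. hval g x * hval h x)"
    by (simp add: times_hgerm_def hval_def)
qed

lemma subspace_vanishing_ideal:
  "module.subspace (*) (vanishing_ideal (Z :: (complex^'n::finite) set))"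
proof (rule module.subspaceI[OF module_mult])
  show "0 \<in> vanishing_ideal Z"
    using hval_0 by (auto simp: vanishing_ideal_def elim: eventually_mono)
next
  fix g h assume "g \<in> vanishing_ideal Z" "h \<in> vanishing_ideal Z"
  then have "\<forall>\<^sub>F x in nhds 0. x \<in> Z \<longrightarrow> hval g x = 0" "\<forall>\<^sub>F x in nhds 0. x \<in> Z \<longrightarrow> hval h x = 0"
    by (simp_all add: vanishing_ideal_def)
  with hval_add[of g h] show "g + h \<in> vanishing_ideal Z"
    unfolding vanishing_ideal_def mem_Collect_eq by eventually_elim simp
next
  fix g h :: "'n hgerm" assume "h \<in> vanishing_ideal Z"
  then have "\<forall>\<^sub>F x in nhds 0. x \<in> Z \<longrightarrow> hval h x = 0"
    by (simp add: vanishing_ideal_def)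
  with hval_mult[of g h] show "g * h \<in> vanishing_ideal Z"
    unfolding vanishing_ideal_def mem_Collect_eq by eventually_elim simp
qed

text \<open>Complex scalars act as constant germs, so every ideal is a complex subspace.\<close>

lemma subspace_germ_scale:
  assumes "module.subspace (*) (I :: 'n::finite hgerm set)"
  shows "module.subspace germ_scale I"
proof -
  interpret vector_space "germ_scale :: complex \<Rightarrow> 'n hgerm \<Rightarrow> _" by (rule vector_space_germ_scale)
  show ?thesis
    using assms by (auto simp: subspace_def module.subspace_def[OF module_mult] germ_scale_def)
qed

section \<open>Logarithmic vector fields and contraction with a 1-form\<close>

lemma vf_apply_simps:
  "vf_apply 0 g = 0"
  "vf_apply (\<xi> + \<eta>) g = vf_apply \<xi> g + vf_apply \<eta> g"
  "vf_apply (vfield_scale c \<xi>) g = hconst c * vf_apply \<xi> g"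
  by (simp_all add: vf_apply_def vfield_scale_def sum.distrib ring_distribs sum_distrib_left mult.assoc)

lemma subspace_log_vfields:
  "module.subspace vfield_scale (log_vfields (X :: (complex^'n::finite) set))"
proof -
  interpret vector_space "vfield_scale :: complex \<Rightarrow> 'n vfield \<Rightarrow> _" by (rule vector_space_vfield_scale)
  show ?thesis
    using subspace_vanishing_ideal[of X]
    by (auto simp: subspace_def module.subspace_def[OF module_mult] log_vfields_def vf_apply_simps
        image_subset_iff)
qed

lemma linear_form_apply: "Vector_Spaces.linear vfield_scale germ_scale (form_apply \<omega>)"
  by (simp add: Vector_Spaces.linear_iff vector_space_vfield_scale vector_space_germ_scale form_apply_def
      vfield_scale_def germ_scale_def sum.distrib ring_distribs sum_distrib_left mult.left_commute)

lemma subspace_range_form_apply: "module.subspace (*) (range (form_apply \<omega>))"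
proof (rule module.subspaceI[OF module_mult])
  show "0 \<in> range (form_apply \<omega>)"
    by (rule range_eqI[of _ _ 0]) (simp add: form_apply_def)
next
  fix x y assume "x \<in> range (form_apply \<omega>)" "y \<in> range (form_apply \<omega>)"
  then obtain \<xi> \<eta> where "x = form_apply \<omega> \<xi>" "y = form_apply \<omega> \<eta>" by blast
  then show "x + y \<in> range (form_apply \<omega>)"
    by (intro range_eqI[of _ _ "\<xi> + \<eta>"]) (simp add: form_apply_def sum.distrib ring_distribs)
next
  fix c x assume "x \<in> range (form_apply \<omega>)"
  then obtain \<xi> where "x = form_apply \<omega> \<xi>" by blast
  then show "c * x \<in> range (form_apply \<omega>)"
    by (intro range_eqI[of _ _ "c *s \<xi>"])
      (simp add: form_apply_def sum_distrib_left mult_ac)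
qed

lemma form_apply_axis: "form_apply \<omega> (axis j 1) = \<omega> $ j"
  by (simp add: form_apply_def axis_def if_distrib[of "(*) _"] cong: if_cong)

text \<open>The coefficients of a vector field are arbitrary germs, so its contractions are all
  combinations of the coefficients of \<open>\<omega>\<close>; the coordinate fields give the
  generators.\<close>

lemma range_form_apply: "range (form_apply \<omega>) = ideal_gen (range (($) \<omega>))"
  unfolding ideal_gen_def
proof
  interpret module "(*) :: 'a hgerm \<Rightarrow> 'a hgerm \<Rightarrow> _" by (rule module_mult)
  show "range (form_apply \<omega>) \<subseteq> span (range (($) \<omega>))"
  proof
    fix x assume "x \<in> range (form_apply \<omega>)"
    then obtain \<xi> where x: "x = (\<Sum>j\<in>UNIV. \<xi> $ j * \<omega> $ j)"
      by (auto simp: form_apply_def mult.commute)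
    show "x \<in> span (range (($) \<omega>))"
      unfolding x by (intro span_sum span_scale span_base rangeI)
  qed
  show "span (range (($) \<omega>)) \<subseteq> range (form_apply \<omega>)"
  proof (rule span_minimal)
    show "subspace (range (form_apply \<omega>))" by (rule subspace_range_form_apply)
    have "\<omega> $ j = form_apply \<omega> (axis j 1)" for j
      by (rule form_apply_axis[symmetric])
    then show "range (($) \<omega>) \<subseteq> range (form_apply \<omega>)" by blast
  qed
qed

lemma ideal_gen_insert: "ideal_gen (insert f S) = ideal_gen S + ideal_gen {f}"
proof -
  interpret module "(*) :: 'a \<Rightarrow> 'a \<Rightarrow> _" by (rule module_mult)
  show ?thesis
    using span_Un[of S "{f}"] by (auto simp: ideal_gen_def set_plus_def)
qed

section \<open>The two identities and their difference\<close>

theorem proposition4p1: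
  fixes X V :: "(complex^'n) set" and \<omega> :: "'n oneform" and f :: "'n hgerm"
  assumes "analytic_set_germ X"
    and "isolated_singularity_form \<omega>"
    and "mu_BR \<omega> X < \<infinity>"
    and "hypersurface_germ V f"
    and "isolated_singularity_set V"
    and "invariant_by V \<omega>"
  shows "mu_BR \<omega> X = mu_0 \<omega> + mu_bar X \<omega> \<and>
         tau_BR \<omega> X V = tau_0 \<omega> f + tau_bar X \<omega> f \<and>
         ereal_of_enat (mu_BR \<omega> X) - ereal_of_enat (tau_BR \<omega> X V) =
           ereal_of_enat (mu_0 \<omega>) - ereal_of_enat (tau_0 \<omega> f)
           + ereal_of_enat (mu_bar X \<omega>) - ereal_of_enat (tau_bar X \<omega> f)"
proof -
  define L where "L = form_apply \<omega>"
  have lin: "Vector_Spaces.linear vfield_scale germ_scale L"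
    unfolding L_def by (rule linear_form_apply)
  interpret L: Vector_Spaces.linear vfield_scale germ_scale L by fact
  interpret g: complex_vector_space "germ_scale :: complex \<Rightarrow> 'n hgerm \<Rightarrow> _" ..
  note logX = subspace_log_vfields[of X]
  have IV: "vanishing_ideal V = ideal_gen {f}"
    using assms by (simp add: hypersurface_germ_def)
  have subV: "L.vs2.subspace (vanishing_ideal V)"
    by (rule subspace_germ_scale[OF subspace_vanishing_ideal])
  \<comment> \<open>The case \<open>I = 0\<close>. The summand \<open>{0}\<close> is the neutral
    element of set addition and drops out through \<open>set_zero\<close>.\<close>
  have "quotient_dim germ_scale (L ` log_vfields X + {0}) =
      quotient_dim germ_scale (range L + {0}) + quotient_dim vfield_scale (log_vfields X + L -` {0})"
    by (rule quotient_dim_image_plus[OF lin logX L.vs2.subspace_single_0])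
  moreover have "L -` {0} = kernel_vfields \<omega>"
    by (auto simp: L_def kernel_vfields_def)
  ultimately have mu: "mu_BR \<omega> X = mu_0 \<omega> + mu_bar X \<omega>"
    by (simp add: mu_BR_def mu_0_def mu_bar_def L_def range_form_apply flip: set_zero)
  \<comment> \<open>The case of the ideal of \<open>V\<close>, which \<open>f\<close> generates
    because it is a reduced equation.\<close>
  have "quotient_dim germ_scale (L ` log_vfields X + vanishing_ideal V) =
      quotient_dim germ_scale (range L + vanishing_ideal V) +
      quotient_dim vfield_scale (log_vfields X + L -` vanishing_ideal V)"
    by (rule quotient_dim_image_plus[OF lin logX subV])
  moreover have "L -` vanishing_ideal V = relative_vfields \<omega> f"
    by (auto simp: L_def relative_vfields_def IV)
  moreover have "range L + vanishing_ideal V = ideal_gen (insert f (range (($) \<omega>)))"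
    unfolding L_def range_form_apply IV by (rule ideal_gen_insert[symmetric])
  ultimately have tau: "tau_BR \<omega> X V = tau_0 \<omega> f + tau_bar X \<omega> f"
    unfolding tau_BR_def tau_0_def tau_bar_def L_def[symmetric] by (simp only:)
  have sub: "L.vs2.subspace (L ` log_vfields X)"
    by (rule L.subspace_image[OF logX])
  \<comment> \<open>Finiteness of \<open>mu_BR\<close> passes to \<open>tau_BR\<close>, a quotient
    by a larger subspace; this excludes differences of infinities below.\<close>
  have "L ` log_vfields X \<subseteq> L ` log_vfields X + vanishing_ideal V"
    using set_zero_plus2[OF L.vs2.subspace_0[OF subV]] by (subst add.commute)
  moreover have "\<exists>B. quotient_basis germ_scale (L ` log_vfields X) B"
    using assms(3) quotient_dim_eq_infinity_iff[of germ_scale "L ` log_vfields X"]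
    by (auto simp: mu_BR_def L_def)
  ultimately have "\<exists>B. quotient_basis germ_scale (L ` log_vfields X + vanishing_ideal V) B"
    using g.quotient_dim_antimono_finite[OF sub subspace_plus[OF L.vs2.module_axioms sub subV]] by blast
  then have "tau_BR \<omega> X V \<noteq> \<infinity>"
    using quotient_dim_eq_infinity_iff[of germ_scale "L ` log_vfields X + vanishing_ideal V"]
    by (simp add: tau_BR_def L_def)
  \<comment> \<open>A sum in \<open>enat\<close> is finite only if both summands are, so the
    difference formula reduces to arithmetic with finite numbers.\<close>
  then obtain m0 mb t0 tb where
    "mu_0 \<omega> = enat m0" "mu_bar X \<omega> = enat mb" "tau_0 \<omega> f = enat t0" "tau_bar X \<omega> f = enat tb"
    using assms(3) mu tau by (auto simp: plus_eq_infty_iff_enat)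
  then show ?thesis
    using mu tau by simp
qed

end
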